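(* For every finite connected graph $G$, $\mathcal{L}(G)\le \operatorname{pw}(G)+1$.
   Context: Lions and contamination game. Let $G=(V,E)$ be a finite graph, $N(v)$ the set of neighbours of $v$. A lion strategy with $k\ge 1$ lions consists of initial positions $p_1(0),\dots,p_k(0)\in V$ and, for each $t\ge 1$, positions $p_i(t)\in\{p_i(t-1)\}\cup N(p_i(t-1))$. Put $L_t=\{p_i(t)\}_i$, $\pi_t=\{(p_i(t-1),p_i(t))\}_i$. Contaminated sets: $W_0=V\setminus L_0$, and for $t\ge1$, $W_t=(W_{t-1}\setminus L_t)\cup\{v\in V\setminus L_t:\exists w\in W_{t-1}\cap N(v)\text{ with }(v,w)\notin\pi_t,(w,v)\notin\pi_t\}$. The strategy clears $G$ if $W_T=\emptyset$ for some $T$; $\mathcal{L}(G)$ is the minimum number of lions of a clearing strategy. $\operatorname{pw}(G)$ denotes the pathwidth of $G$. *)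

theory Defs
  imports "Graph_Theory.Graph_Theory"
begin

text \<open>
  Finite simple graphs are the symmetric, loop-free, finite digraphs without parallel arcs
  of the locale \<^locale>\<open>graph\<close>; an undirected edge is a pair of opposite arcs.
\<close>

definition neighbours :: "('a, 'b) pre_digraph \<Rightarrow> 'a \<Rightarrow> 'a set" where
  "neighbours G v = {w. v \<rightarrow>\<^bsub>G\<^esub> w}"


subsection \<open>Lions and contamination\<close>

text \<open>The position of lion \<open>i < k\<close> at time \<open>t\<close> is \<open>p i t\<close>; values for \<open>i \<ge> k\<close> are irrelevant.\<close>

definition lion_strategy :: "('a, 'b) pre_digraph \<Rightarrow> nat \<Rightarrow> (nat \<Rightarrow> nat \<Rightarrow> 'a) \<Rightarrow> bool" where
  "lion_strategy G k p \<longleftrightarrow>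
     (\<forall>i<k. p i 0 \<in> verts G \<and>
       (\<forall>t\<ge>1. p i t \<in> {p i (t - 1)} \<union> neighbours G (p i (t - 1))))"

definition lions :: "nat \<Rightarrow> (nat \<Rightarrow> nat \<Rightarrow> 'a) \<Rightarrow> nat \<Rightarrow> 'a set" where
  "lions k p t = (\<lambda>i. p i t) ` {..<k}"

text \<open>Only used for \<open>t \<ge> 1\<close>.\<close>

definition lion_moves :: "nat \<Rightarrow> (nat \<Rightarrow> nat \<Rightarrow> 'a) \<Rightarrow> nat \<Rightarrow> ('a \<times> 'a) set" where
  "lion_moves k p t = (\<lambda>i. (p i (t - 1), p i t)) ` {..<k}"

fun contaminated ::
  "('a, 'b) pre_digraph \<Rightarrow> nat \<Rightarrow> (nat \<Rightarrow> nat \<Rightarrow> 'a) \<Rightarrow> nat \<Rightarrow> 'a set" where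
  "contaminated G k p 0 = verts G - lions k p 0"
| "contaminated G k p (Suc t) =
     (contaminated G k p t - lions k p (Suc t)) \<union>
     {v \<in> verts G - lions k p (Suc t).
        \<exists>w \<in> contaminated G k p t \<inter> neighbours G v.
          (v, w) \<notin> lion_moves k p (Suc t) \<and> (w, v) \<notin> lion_moves k p (Suc t)}"

definition clears :: "('a, 'b) pre_digraph \<Rightarrow> nat \<Rightarrow> (nat \<Rightarrow> nat \<Rightarrow> 'a) \<Rightarrow> bool" where
  "clears G k p \<longleftrightarrow> (\<exists>T. contaminated G k p T = {})"

definition lion_number :: "('a, 'b) pre_digraph \<Rightarrow> nat" where
  "lion_number G = (LEAST k. k \<ge> 1 \<and> (\<exists>p. lion_strategy G k p \<and> clears G k p))"


subsection \<open>Pathwidth\<close>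

definition path_decomposition :: "('a, 'b) pre_digraph \<Rightarrow> 'a set list \<Rightarrow> bool" where
  "path_decomposition G Xs \<longleftrightarrow>
     Xs \<noteq> [] \<and>
     \<Union> (set Xs) = verts G \<and>
     (\<forall>u v. u \<rightarrow>\<^bsub>G\<^esub> v \<longrightarrow> (\<exists>X \<in> set Xs. u \<in> X \<and> v \<in> X)) \<and>
     (\<forall>i j l. i \<le> j \<and> j \<le> l \<and> l < length Xs \<longrightarrow> Xs ! i \<inter> Xs ! l \<subseteq> Xs ! j)"

text \<open>
  The subtraction does not truncate when \<open>Xs\<close> decomposes a finite graph with a nonempty
  vertex set, since then some bag is nonempty.
\<close>

definition decomposition_width :: "'a set list \<Rightarrow> nat" where
  "decomposition_width Xs = Max (card ` set Xs) - 1"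

definition pathwidth :: "('a, 'b) pre_digraph \<Rightarrow> nat" where
  "pathwidth G = (LEAST w. \<exists>Xs. path_decomposition G Xs \<and> decomposition_width Xs = w)"


subsection \<open>Both minima are over nonempty sets\<close>

lemma (in graph) path_decomposition_exists: "path_decomposition G [verts G]"
  by (auto simp: path_decomposition_def dest: adj_in_verts)

lemma (in graph) clearing_strategy_exists:
  assumes "verts G \<noteq> {}"
  shows "\<exists>k\<ge>1. \<exists>p. lion_strategy G k p \<and> clears G k p"
proof -
  obtain f where f: "f ` {..<card (verts G)} = verts G"
    using ex_bij_betw_nat_finite[OF finite_verts] by (auto simp: bij_betw_def lessThan_atLeast0)
  let ?p = "\<lambda>i t. f i"
  have "lion_strategy G (card (verts G)) ?p"
    using f by (auto simp: lion_strategy_def)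
  moreover have "contaminated G (card (verts G)) ?p 0 = {}"
    using f by (simp add: lions_def)
  hence "clears G (card (verts G)) ?p"
    unfolding clears_def by blast
  moreover have "card (verts G) \<ge> 1"
    using assms by (simp add: Suc_le_eq card_gt_0_iff)
  ultimately show ?thesis by blast
qed

end

theory Submission
  imports Defs
begin

text \<open>
  Sweep along an optimal path decomposition \<open>X\<^sub>0, \<dots>, X\<^sub>n\<close> with one lion per vertex of the
  current bag, keeping \<open>X\<^sub>0 \<union> \<dots> \<union> X\<^sub>i\<close> clean while \<open>X\<^sub>i\<close> is occupied. To pass to the next bag, one
  lion stays on each vertex of \<open>X\<^sub>i \<inter> X\<^sub>i\<^sub>+\<^sub>1\<close>; this set separates \<open>X\<^sub>0 \<union> \<dots> \<union> X\<^sub>i\<close> from the rest,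
  so no recontamination occurs while the remaining lions walk, by connectedness, to the
  vertices of \<open>X\<^sub>i\<^sub>+\<^sub>1 - X\<^sub>i\<close>.
\<close>

text \<open>Assigns targets \<open>D\<close> to lions \<open>J\<close> when there may be more lions
  than targets: invert an injection of \<open>D\<close> into \<open>J\<close> and send the surplus
  indices to an arbitrary element of \<open>V\<close>.\<close>

lemma card_le_imp_covering_map:
  assumes "finite D" "finite J" "card D \<le> card J" "D \<subseteq> V" "V \<noteq> {}"
  shows "\<exists>h. D \<subseteq> h ` J \<and> h ` J \<subseteq> V"
proof -
  obtain f where f: "f ` D \<subseteq> J" "inj_on f D"
    using card_le_inj[OF assms(1-3)] by blast
  obtain v where "v \<in> V" using assms by blast
  let ?h = "\<lambda>j. if j \<in> f ` D then inv_into D f j else v"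
  have "x \<in> ?h ` J" if "x \<in> D" for x
  proof (rule image_eqI)
    show "f x \<in> J" "x = ?h (f x)" using f that by auto
  qed
  moreover have "?h ` J \<subseteq> V"
    using \<open>v \<in> V\<close> assms(4) f(2) by auto
  ultimately show ?thesis by blast
qed

lemma lions_cong:
  assumes "\<And>i. i < k \<Longrightarrow> p i t = q i t"
  shows "lions k p t = lions k q t"
  using assms by (auto simp: lions_def)

text \<open>Contamination at time \<open>t\<close> depends only on the positions up to
  \<open>t\<close>, so a strategy can be given a new continuation without changing its past.\<close>

lemma contaminated_cong:
  assumes "\<And>i s. i < k \<Longrightarrow> s \<le> t \<Longrightarrow> p i s = q i s"
  shows "contaminated G k p t = contaminated G k q t"
  using assms
proof (induction t)
  case 0
  then show ?case using lions_cong[of k p 0 q] by simp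
next
  case (Suc t)
  have "contaminated G k p t = contaminated G k q t"
    using Suc by simp
  moreover have "lions k p (Suc t) = lions k q (Suc t)"
    using Suc.prems by (intro lions_cong) simp
  moreover have "lion_moves k p (Suc t) = lion_moves k q (Suc t)"
    using Suc.prems by (auto simp: lion_moves_def)
  ultimately show ?case by simp
qed

lemma contaminated_Int_lions: "contaminated G k p t \<inter> lions k p t = {}"
  by (cases t) auto

lemma contaminated_subset_verts: "contaminated G k p t \<subseteq> verts G"
  by (induction t) auto

text \<open>A vertex of \<open>A\<close> can only be recontaminated by a neighbour outside
  \<open>A\<close>, and while unoccupied. The second assumption rules this out by placing a lion on
  every such boundary vertex at the new time.\<close>

lemma contaminated_Suc_avoids_guarded:
  assumes "contaminated G k p t \<inter> A = {}"
    and "\<And>v w. v \<in> A \<Longrightarrow> w \<notin> A \<Longrightarrow> v \<rightarrow>\<^bsub>G\<^esub> w \<Longrightarrow> v \<in> lions k p (Suc t)"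
  shows "contaminated G k p (Suc t) \<inter> A = {}"
  using assms by (auto simp: neighbours_def)

context graph
begin

lemma lion_strategy_in_verts:
  assumes "lion_strategy G k p" "i < k"
  shows "p i t \<in> verts G"
proof (induction t)
  case 0
  then show ?case using assms by (simp add: lion_strategy_def)
next
  case (Suc t)
  have "p i (Suc t) \<in> {p i (Suc t - 1)} \<union> neighbours G (p i (Suc t - 1))"
    using assms unfolding lion_strategy_def by (metis le_add1 plus_1_eq_Suc)
  then show ?case
    using Suc by (auto simp: neighbours_def dest: adj_in_verts)
qed

text \<open>Since lions may wait, each walk is padded to an infinite one that rests at its target.
  Walks of different lengths can then run side by side.\<close>

lemma reachable_imp_lazy_walk:
  assumes "u \<rightarrow>\<^sup>* v"
  shows "\<exists>q M. q 0 = u \<and> (\<forall>m. q (Suc m) \<in> {q m} \<union> neighbours G (q m)) \<and> (\<forall>m\<ge>M::nat. q m = v)"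
  using assms
proof (induction rule: reachable_induct)
  case base
  show ?case by (rule exI[of _ "\<lambda>_. u"]) simp
next
  case (step x y)
  then obtain q M where q: "q 0 = u" "\<And>m. q (Suc m) \<in> {q m} \<union> neighbours G (q m)"
    and M: "\<And>m. m \<ge> M \<Longrightarrow> q m = x"
    by blast
  let ?q = "\<lambda>m. if m \<le> M then q m else y"
  have "?q (Suc m) \<in> {?q m} \<union> neighbours G (?q m)" for m
    using q(2)[of m] M[of m] step by (auto simp: neighbours_def)
  then show ?case
    using q(1) by (intro exI[of _ ?q] exI[of _ "Suc M"]) auto
qed

text \<open>A bag containing both ends of the edge has index above \<open>n\<close>, because of
  \<open>w\<close>. As \<open>v\<close> also lies in a bag of index at most \<open>n\<close>, the
  interval property puts it in both bags in between.\<close>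

lemma separator_of_path_decomposition:
  assumes "path_decomposition G Xs" "Suc n < length Xs"
    and "v \<in> (\<Union>j\<le>n. Xs ! j)" "w \<notin> (\<Union>j\<le>n. Xs ! j)" "v \<rightarrow> w"
  shows "v \<in> Xs ! n \<inter> Xs ! Suc n"
proof -
  have mono: "Xs ! i \<inter> Xs ! l \<subseteq> Xs ! j" if "i \<le> j" "j \<le> l" "l < length Xs" for i j l
    using assms(1) that unfolding path_decomposition_def by blast
  obtain X where "X \<in> set Xs" "v \<in> X" "w \<in> X"
    using assms(1,5) unfolding path_decomposition_def by blast
  then obtain l where l: "l < length Xs" "v \<in> Xs ! l" "w \<in> Xs ! l"
    by (metis in_set_conv_nth)
  with assms(4) have "Suc n \<le> l"
    by (metis UN_I atMost_iff not_less_eq_eq)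
  moreover obtain j where "j \<le> n" "v \<in> Xs ! j" using assms(3) by blast
  ultimately show ?thesis
    using mono[of j n l] mono[of j "Suc n" l] l by auto
qed

lemma extend_strategy_to_next_bag:
  assumes conn: "strongly_connected G"
    and dec: "path_decomposition G Xs" and n: "Suc n < length Xs"
    and card: "card (Xs ! Suc n) \<le> k"
    and strat: "lion_strategy G k p"
    and occ: "Xs ! n \<subseteq> lions k p T"
    and clean: "contaminated G k p T \<inter> (\<Union>j\<le>n. Xs ! j) = {}"
  shows "\<exists>p T. lion_strategy G k p \<and> Xs ! Suc n \<subseteq> lions k p T \<and>
    contaminated G k p T \<inter> (\<Union>j\<le>Suc n. Xs ! j) = {}"
proof -
  let ?A = "\<Union>j\<le>n. Xs ! j" and ?C = "Xs ! n \<inter> Xs ! Suc n"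
  have sub: "Xs ! Suc n \<subseteq> verts G"
    using dec n unfolding path_decomposition_def by (metis Union_upper nth_mem)
  have fin: "finite (Xs ! Suc n)" using sub finite_subset finite_verts by blast
  have "?C \<subseteq> (\<lambda>i. p i T) ` {..<k}" using occ by (auto simp: lions_def)
  \<comment> \<open>\<open>I\<close> selects exactly one guard per vertex of \<open>?C\<close>, so
    \<open>card I = card ?C\<close> and the other lions are numerous enough to cover the rest of the
    next bag.\<close>
  then obtain I where I: "I \<subseteq> {..<k}" "inj_on (\<lambda>i. p i T) I" "?C = (\<lambda>i. p i T) ` I"
    unfolding subset_image_inj by blast
  have "finite I" using I(1) finite_subset by blast
  have "card (Xs ! Suc n - ?C) = card (Xs ! Suc n) - card I"
    using I fin by (metis Int_lower2 card_Diff_subset card_image finite_Int)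
  also have "\<dots> \<le> card ({..<k} - I)"
    using card I(1) \<open>finite I\<close> by (simp add: card_Diff_subset)
  finally obtain h where h: "Xs ! Suc n - ?C \<subseteq> h ` ({..<k} - I)" "h ` ({..<k} - I) \<subseteq> verts G"
    using card_le_imp_covering_map[of "Xs ! Suc n - ?C" "{..<k} - I" "verts G"] fin sub conn
    by (auto simp: strongly_connected_def)
  \<comment> \<open>Guards must stand still for all \<open>m\<close>, not just from \<open>M\<close>
    on, because the separator has to be occupied throughout the transition.\<close>
  define walks where "walks i q M \<longleftrightarrow> q 0 = p i T \<and>
      (\<forall>m. q (Suc m) \<in> {q m} \<union> neighbours G (q m)) \<and>
      (\<forall>m\<ge>M. q m = (if i \<in> I then p i T else h i)) \<and> (i \<in> I \<longrightarrow> (\<forall>m. q m = p i T))"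
    for i and q :: "nat \<Rightarrow> 'a" and M :: nat
  have "\<exists>q M. walks i q M"
    if "i < k" for i
  proof (cases "i \<in> I")
    case True
    then show ?thesis unfolding walks_def by (intro exI[of _ "\<lambda>_. p i T"]) simp
  next
    case False
    then have "p i T \<rightarrow>\<^sup>* h i"
      using conn h(2) that lion_strategy_in_verts[OF strat that]
      by (auto simp: strongly_connected_def)
    from reachable_imp_lazy_walk[OF this] False show ?thesis unfolding walks_def by simp
  qed
  then obtain q M where walks: "\<And>i. i < k \<Longrightarrow> walks i (q i) (M i)"
    by metis
  have q0: "q i 0 = p i T"
    and qS: "q i (Suc m) \<in> {q i m} \<union> neighbours G (q i m)"
    and qM: "m \<ge> M i \<Longrightarrow> q i m = (if i \<in> I then p i T else h i)"
    and qI: "i \<in> I \<Longrightarrow> q i m = p i T" if "i < k" for i m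
    using walks[OF that] unfolding walks_def by blast+
  \<comment> \<open>The two pieces agree at time \<open>T\<close>, since
    \<open>q i 0 = p i T\<close>.\<close>
  define p' where "p' i t = (if t \<le> T then p i t else q i (t - T))" for i t
  have p'q: "p' i (T + m) = q i m" if "i < k" for i m
    using q0[OF that] by (cases m) (auto simp: p'_def)
  have "p' i t \<in> {p' i (t - 1)} \<union> neighbours G (p' i (t - 1))" if "i < k" "t \<ge> 1" for i t
  proof (cases "t \<le> T")
    case True
    then show ?thesis using strat that unfolding p'_def lion_strategy_def by auto
  next
    case False
    then obtain m where "t = T + Suc m" by (metis less_iff_Suc_add add_Suc_right not_le)
    then show ?thesis
      using p'q[OF that(1), of "Suc m"] p'q[OF that(1), of m] qS[OF that(1), of m] by simp
  qed
  moreover have "p' i 0 \<in> verts G" if "i < k" for i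
    using strat that by (simp add: p'_def lion_strategy_def)
  ultimately have strat': "lion_strategy G k p'"
    unfolding lion_strategy_def by blast
  have guard: "?C \<subseteq> lions k p' (T + m)" for m
  proof -
    have "p i T \<in> lions k p' (T + m)" if "i \<in> I" for i
    proof -
      have "i < k" using I(1) that by blast
      then have "p i T = p' i (T + m)" using p'q qI that by simp
      then show ?thesis using \<open>i < k\<close> unfolding lions_def by blast
    qed
    then show ?thesis unfolding I(3) by blast
  qed
  have clean': "contaminated G k p' (T + m) \<inter> ?A = {}" for m
  proof (induction m)
    case 0
    have "contaminated G k p' T = contaminated G k p T"
      by (rule contaminated_cong) (simp add: p'_def)
    then show ?case using clean by simp
  next
    case (Suc m)
    show ?case
      unfolding add_Suc_right
    proof (rule contaminated_Suc_avoids_guarded[OF Suc])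
      fix v w assume "v \<in> ?A" "w \<notin> ?A" "v \<rightarrow> w"
      then have "v \<in> ?C" using separator_of_path_decomposition[OF dec n] by blast
      then show "v \<in> lions k p' (Suc (T + m))" using guard[of "Suc m"] by auto
    qed
  qed
  \<comment> \<open>By the latest arrival time every free lion rests on its target.\<close>
  let ?T = "T + Max (M ` {..<k})"
  have "Xs ! Suc n - ?C \<subseteq> lions k p' ?T"
  proof
    fix x assume "x \<in> Xs ! Suc n - ?C"
    then obtain i where i: "i < k" "i \<notin> I" "x = h i" using h(1) by blast
    then have "M i \<le> Max (M ` {..<k})" by simp
    then have "x = p' i ?T" using i p'q qM by simp
    then show "x \<in> lions k p' ?T" using i unfolding lions_def by blast
  qed
  with guard[of "Max (M ` {..<k})"] have occ': "Xs ! Suc n \<subseteq> lions k p' ?T" by blast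
  \<comment> \<open>The old bags are clean by \<open>clean'\<close>, the new one because it is
    occupied.\<close>
  then have "contaminated G k p' ?T \<inter> (\<Union>j\<le>Suc n. Xs ! j) = {}"
    using clean'[of "Max (M ` {..<k})"] contaminated_Int_lions[of G k p' ?T]
    by (auto simp: atMost_Suc)
  with strat' occ' show ?thesis by blast
qed

text \<open>Induction on the index of the occupied bag; at the last index the bags swept so far
  cover \<open>verts G\<close>.\<close>

lemma clearing_strategy_of_path_decomposition:
  assumes conn: "strongly_connected G" and dec: "path_decomposition G Xs"
    and card: "\<And>X. X \<in> set Xs \<Longrightarrow> card X \<le> k"
  shows "\<exists>p. lion_strategy G k p \<and> clears G k p"
proof -
  have ne: "Xs \<noteq> []" and Un: "\<Union> (set Xs) = verts G"
    using dec by (auto simp: path_decomposition_def)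
  have step: "\<exists>p T. lion_strategy G k p \<and> Xs ! n \<subseteq> lions k p T \<and>
    contaminated G k p T \<inter> (\<Union>j\<le>n. Xs ! j) = {}" if "n < length Xs" for n
    using that
  proof (induction n)
    case 0
    have mem: "Xs ! 0 \<in> set Xs" using ne by simp
    then have sub: "Xs ! 0 \<subseteq> verts G" using Un by blast
    obtain h where h: "Xs ! 0 \<subseteq> h ` {..<k}" "h ` {..<k} \<subseteq> verts G"
      using card_le_imp_covering_map[of "Xs ! 0" "{..<k}" "verts G"] sub card[OF mem] conn
        finite_subset[OF sub finite_verts]
      by (auto simp: strongly_connected_def)
    \<comment> \<open>Lions standing still on the first bag, observed at time 0.\<close>
    then show ?case
      by (intro exI[of _ "\<lambda>i _. h i"] exI[of _ 0]) (auto simp: lion_strategy_def lions_def)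
  next
    case (Suc n)
    then obtain p T where "lion_strategy G k p" "Xs ! n \<subseteq> lions k p T"
      "contaminated G k p T \<inter> (\<Union>j\<le>n. Xs ! j) = {}"
      by auto
    with Suc.prems show ?case
      by (intro extend_strategy_to_next_bag[OF conn dec]) (auto intro: card)
  qed
  have "length Xs - 1 < length Xs" using ne by simp
  from step[OF this] obtain p T where p: "lion_strategy G k p"
    and T: "contaminated G k p T \<inter> (\<Union>j\<le>length Xs - 1. Xs ! j) = {}"
    by blast
  have "verts G \<subseteq> (\<Union>j\<le>length Xs - 1. Xs ! j)"
  proof
    fix v assume "v \<in> verts G"
    then obtain X where "X \<in> set Xs" "v \<in> X" using Un by blast
    then obtain j where "j < length Xs" "v \<in> Xs ! j" by (metis in_set_conv_nth)
    then show "v \<in> (\<Union>j\<le>length Xs - 1. Xs ! j)" by (intro UN_I[of j]) auto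
  qed
  with T contaminated_subset_verts[of G k p T] have "contaminated G k p T = {}" by blast
  with p show ?thesis unfolding clears_def by blast
qed

end

theorem theorem19:
  fixes G :: "('a, 'b) pre_digraph"
  assumes "graph G" and "Digraph_Component.connected G"
  shows "lion_number G \<le> pathwidth G + 1"
proof -
  interpret graph G by fact
  \<comment> \<open>Arcs come in opposite pairs, so every lion can walk to every vertex.\<close>
  have conn: "strongly_connected G"
    by (rule symmetric_connected_imp_strongly_connected[OF sym_arcs assms(2)])
  have "\<exists>Xs. path_decomposition G Xs \<and> decomposition_width Xs = pathwidth G"
    unfolding pathwidth_def by (rule LeastI_ex) (use path_decomposition_exists in blast)
  then obtain Xs where Xs: "path_decomposition G Xs" "decomposition_width Xs = pathwidth G"
    by blast
  have "card X \<le> pathwidth G + 1" if "X \<in> set Xs" for X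
  proof -
    \<comment> \<open>Truncated subtraction is harmless here: \<open>m \<le> (m - 1) + 1\<close>
      holds even for \<open>m = 0\<close>.\<close>
    have "card X \<le> Max (card ` set Xs)" using that by simp
    then show ?thesis using Xs(2) by (simp add: decomposition_width_def)
  qed
  from clearing_strategy_of_path_decomposition[OF conn Xs(1) this]
  show ?thesis
    \<comment> \<open>The summand 1 also ensures the requirement \<open>k \<ge> 1\<close> of the
      minimum.\<close>
    unfolding lion_number_def by (intro Least_le) simp
qed

end
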